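(* Let $\alpha=\sqrt{2/3}$. The functions $$\sqrt{\frac{3^{m+1}}{2}}\,\psi_m(t)=2^{1/4}\sqrt{\frac{1}{2^m m!}}\;e^{-t^2/3}\,\mathrm{H}_m\bigg(\frac{2t}{\sqrt3}\bigg)\quad\text{for } m\in\mathbb{N}_0$$ form an orthonormal basis of $\mathscr{L}_2(\mathbb{R},w_\alpha)$.
   Context: $\mathbb{N}_0=\{0,1,2,\ldots\}$. $\mathrm{H}_m$ is the $m$th physicist's Hermite polynomial, $\mathrm{H}_m(t)=m!\sum_{k=0}^{\lfloor m/2\rfloor}\frac{(-1)^k}{k!(m-2k)!}(2t)^{m-2k}$, and $\psi_m(t)=\big(\frac{2\sqrt2}{3}\big)^{1/2}\sqrt{\frac{1}{6^m m!}}\,e^{-t^2/3}\,\mathrm{H}_m\big(\frac{2t}{\sqrt3}\big)$. The weight function is $w_\alpha(t)=\frac{\alpha}{\sqrt\pi}e^{-\alpha^2t^2}$, and $\mathscr{L}_2(\mathbb{R},w_\alpha)$ is the Hilbert space of functions $f:\mathbb{R}\to\mathbb{C}$ with finite norm for the inner product $\langle f,g\rangle=\int_{-\infty}^\infty f^*(t)g(t)w_\alpha(t)\,dt$, where $^*$ is complex conjugation. *)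

theory Defs
  imports "HOL-Analysis.Analysis"
begin

definition hermite :: "nat \<Rightarrow> real \<Rightarrow> real" where
  "hermite m t =
     fact m * (\<Sum>k = 0..m div 2. (-1) ^ k / (fact k * fact (m - 2 * k)) * (2 * t) ^ (m - 2 * k))"

definition psi :: "nat \<Rightarrow> real \<Rightarrow> real" where
  "psi m t = sqrt (2 * sqrt 2 / 3) * sqrt (1 / (6 ^ m * fact m)) * exp (- (t\<^sup>2 / 3))
     * hermite m (2 * t / sqrt 3)"

definition weight :: "real \<Rightarrow> real \<Rightarrow> real" where
  "weight \<alpha> t = \<alpha> / sqrt pi * exp (- (\<alpha>\<^sup>2 * t\<^sup>2))"

text \<open>
  The elements of the weighted space \<open>L2w \<alpha>\<close> are represented by Lebesgue measurable functions
  rather than by their classes modulo equality almost everywhere.  Thus \<open>L2w_norm \<alpha>\<close> is a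
  seminorm on functions and the norm on classes; all notions below depend only on the classes.
\<close>

definition L2w :: "real \<Rightarrow> (real \<Rightarrow> complex) set" where
  "L2w \<alpha> = {f. f \<in> borel_measurable lebesgue \<and>
                integrable lebesgue (\<lambda>t. (cmod (f t))\<^sup>2 * weight \<alpha> t)}"

definition L2w_inner :: "real \<Rightarrow> (real \<Rightarrow> complex) \<Rightarrow> (real \<Rightarrow> complex) \<Rightarrow> complex" where
  "L2w_inner \<alpha> f g = (LINT t|lebesgue. cnj (f t) * g t * complex_of_real (weight \<alpha> t))"

definition L2w_norm :: "real \<Rightarrow> (real \<Rightarrow> complex) \<Rightarrow> real" where
  "L2w_norm \<alpha> f = sqrt (Re (L2w_inner \<alpha> f f))"

text \<open>
  Every finite linear combination of the \<open>e m\<close> is a combination over an initial segment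
  \<open>{..<N}\<close> with some coefficients zero, so the last conjunct says that the complex-linear
  span of \<open>e\<close> is dense in \<open>L2w \<alpha>\<close>.
\<close>

definition L2w_orthonormal_basis :: "real \<Rightarrow> (nat \<Rightarrow> real \<Rightarrow> complex) \<Rightarrow> bool" where
  "L2w_orthonormal_basis \<alpha> e \<longleftrightarrow>
     (\<forall>m. e m \<in> L2w \<alpha>) \<and>
     (\<forall>m n. L2w_inner \<alpha> (e m) (e n) = (if m = n then 1 else 0)) \<and>
     (\<forall>f\<in>L2w \<alpha>. \<forall>\<epsilon>>0. \<exists>N. \<exists>c :: nat \<Rightarrow> complex.
        L2w_norm \<alpha> (\<lambda>t. f t - (\<Sum>m<N. c m * e m t)) < \<epsilon>)"

end

theory Submission
  imports Defs "HOL-Probability.Probability" "HOL-Real_Asymp.Real_Asymp"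
begin

text \<open>
  Let $g(t) = 2^{1/4} e^{-t^2/3}$ be the basis function with $m = 0$.  Since $g^2 w_\alpha$ is exactly the
  density of the centred normal law of variance $3/8$ (lemma \<open>ground_state_weight\<close>),
  multiplication by $g$ is an isometry of $L_2$ of that law onto the weighted space.  It maps the
  polynomials $H_m(2t/\sqrt3) / \sqrt{2^m m!}$ to the functions of the theorem.  Hence the claim is that
  these polynomials are an orthonormal basis of $L_2$ of a normal law, and it has two parts.

  \<^emph>\<open>Orthonormality.\<close>  After the substitution $u = 2t/\sqrt3$ the law has density $e^{-u^2}/\sqrt\pi$.
  Integration by parts (\<open>stein_identity\<close>) shows that $H_m \mapsto H_{m+1} = 2u H_m - H_m'$ is adjoint to
  differentiation, and $H_n' = 2n H_{n-1}$; induction gives $\langle H_m, H_n\rangle = \delta_{mn} 2^m m!$.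

  \<^emph>\<open>Completeness.\<close>  The three-term recurrence shows that the Hermite polynomials span all
  polynomials, so it remains to see that polynomials are dense in $L_2(M)$ for every measure $M$ on
  the line with exponential moments (\<open>poly_limit_square_integrable\<close>).  The proof enlarges,
  by dominated convergence, the class of functions known to lie in the closure of the polynomials:
  power series give $e^{iax}$, hence all
  trigonometric polynomials; Weierstrass's theorem applied to $n \sin(x/n) \to x$ gives the bounded
  continuous functions; a Dynkin argument gives the indicators of Borel sets; and
  simple functions give everything.
\<close>

section \<open>Density of polynomials for measures with exponential moments\<close>

locale exponential_moments =
  fixes M :: "real measure"
  assumes sets_M [measurable_cong, simp]: "sets M = sets borel"
    and integrable_exp: "\<And>a. integrable M (\<lambda>x. exp (a * x))"
begin

lemma space_M [simp]: "space M = UNIV"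
  using sets_eq_imp_space_eq[OF sets_M] by simp

sublocale finite_measure M
proof
  have "integrable M (\<lambda>x. 1 :: real)"
    using integrable_exp[of 0] by simp
  then show "emeasure M (space M) \<noteq> \<infinity>"
    by (auto simp: integrable_iff_bounded)
qed

lemma integrable_exp_abs: "integrable M (\<lambda>x. exp (a * \<bar>x\<bar>))"
proof (rule Bochner_Integration.integrable_bound)
  show "integrable M (\<lambda>x. exp (a * x) + exp ((- a) * x))"
    using integrable_exp by (intro Bochner_Integration.integrable_add)
  show "AE x in M. norm (exp (a * \<bar>x\<bar>)) \<le> norm (exp (a * x) + exp ((- a) * x))"
    by (intro AE_I2, unfold real_norm_def, rule order.trans[OF _ abs_ge_self])
       (auto simp: abs_if[of "_ :: real"])
qed simp

definition square_integrable :: "(real \<Rightarrow> complex) \<Rightarrow> bool" where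
  "square_integrable f \<longleftrightarrow> f \<in> borel_measurable M \<and> integrable M (\<lambda>x. (cmod (f x))\<^sup>2)"

text \<open>
  The inequality $|a + b|^2 \le 2|a|^2 + 2|b|^2$ serves as a substitute for the triangle
  inequality of the $L_2$ norm; the lost constant is harmless for density arguments.
\<close>

lemma square_integrable_add:
  assumes "square_integrable f" "square_integrable g"
  shows "square_integrable (\<lambda>x. f x + g x)"
    and "(\<integral>x. (cmod (f x + g x))\<^sup>2 \<partial>M) \<le> 2 * (\<integral>x. (cmod (f x))\<^sup>2 \<partial>M) + 2 * (\<integral>x. (cmod (g x))\<^sup>2 \<partial>M)"
proof -
  have [measurable]: "f \<in> borel_measurable M" "g \<in> borel_measurable M"
    and int: "integrable M (\<lambda>x. 2 * (cmod (f x))\<^sup>2)" "integrable M (\<lambda>x. 2 * (cmod (g x))\<^sup>2)"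
    using assms by (auto simp: square_integrable_def)
  have le: "(cmod (f x + g x))\<^sup>2 \<le> 2 * (cmod (f x))\<^sup>2 + 2 * (cmod (g x))\<^sup>2" for x
  proof -
    have "(cmod (f x + g x))\<^sup>2 \<le> (cmod (f x) + cmod (g x))\<^sup>2"
      by (intro power_mono norm_triangle_ineq) auto
    also have "\<dots> \<le> 2 * (cmod (f x))\<^sup>2 + 2 * (cmod (g x))\<^sup>2"
      using sum_squares_bound[of "cmod (f x)" "cmod (g x)"] by (simp add: power2_sum)
    finally show ?thesis .
  qed
  have int': "integrable M (\<lambda>x. (cmod (f x + g x))\<^sup>2)"
    by (rule Bochner_Integration.integrable_bound[OF Bochner_Integration.integrable_add[OF int]])
       (use le in auto)
  then show "square_integrable (\<lambda>x. f x + g x)"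
    by (simp add: square_integrable_def)
  show "(\<integral>x. (cmod (f x + g x))\<^sup>2 \<partial>M) \<le> 2 * (\<integral>x. (cmod (f x))\<^sup>2 \<partial>M) + 2 * (\<integral>x. (cmod (g x))\<^sup>2 \<partial>M)"
    using integral_mono[OF int' Bochner_Integration.integrable_add[OF int]] le int by simp
qed

lemma square_integrable_mult:
  assumes "square_integrable f"
  shows "square_integrable (\<lambda>x. c * f x)"
  using assms by (auto simp: square_integrable_def norm_mult power_mult_distrib)

lemma square_integrable_diff:
  assumes "square_integrable f" "square_integrable g"
  shows "square_integrable (\<lambda>x. f x - g x)"
  using square_integrable_add(1)[OF assms(1) square_integrable_mult[OF assms(2), of "-1"]] by simp

lemma square_integrable_bounded:
  assumes [measurable]: "f \<in> borel_measurable M" and "\<And>x. cmod (f x) \<le> B"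
  shows "square_integrable f"
  unfolding square_integrable_def using assms
  by (auto intro!: integrable_const_bound[where B = "B\<^sup>2"] AE_I2 power_mono)

text \<open>
  Since \<open>\<bar>x\<bar> \<le> exp \<bar>x\<bar>\<close>, a polynomial of degree $n$ grows at most like \<open>exp (n * \<bar>x\<bar>)\<close>.
  This turns exponential moments into square integrability of polynomials.
\<close>

lemma poly_exp_bound:
  fixes p :: "complex poly"
  shows "\<exists>C n. 0 \<le> C \<and> (\<forall>x. cmod (poly p (of_real x)) \<le> C * exp (real n * \<bar>x\<bar>))"
proof (induction p)
  case 0
  then show ?case by (auto intro!: exI[of _ 0])
next
  case (pCons a p)
  then obtain C n where C: "0 \<le> C" "\<And>x. cmod (poly p (of_real x)) \<le> C * exp (real n * \<bar>x\<bar>)"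
    by auto
  have "cmod (poly (pCons a p) (of_real x)) \<le> (cmod a + C) * exp (real (Suc n) * \<bar>x\<bar>)" for x
  proof -
    have "cmod (poly (pCons a p) (of_real x)) \<le> cmod a + \<bar>x\<bar> * cmod (poly p (of_real x))"
      by (auto simp: norm_mult intro: order.trans[OF norm_triangle_ineq])
    also have "\<dots> \<le> cmod a * exp (real (Suc n) * \<bar>x\<bar>) + exp \<bar>x\<bar> * (C * exp (real n * \<bar>x\<bar>))"
      using exp_ge_add_one_self[of "\<bar>x\<bar>"] C
      by (intro add_mono mult_mono) (auto simp: mult_le_cancel_left1 simp del: exp_ge_add_one_self)
    also have "\<dots> = (cmod a + C) * exp (real (Suc n) * \<bar>x\<bar>)"
      by (simp add: algebra_simps exp_add)
    finally show ?thesis .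
  qed
  then show ?case
    using C(1) by (intro exI[of _ "cmod a + C"] exI[of _ "Suc n"]) auto
qed

lemma square_integrable_exp_bounded:
  assumes [measurable]: "f \<in> borel_measurable M" and le: "\<And>x. cmod (f x) \<le> C * exp (b * \<bar>x\<bar>)"
  shows "square_integrable f"
proof -
  have "(cmod (f x))\<^sup>2 \<le> C\<^sup>2 * exp (2 * b * \<bar>x\<bar>)" for x
    using power_mono[OF le[of x], of 2]
    by (simp add: power_mult_distrib exp_double[symmetric] mult_ac)
  then have "integrable M (\<lambda>x. (cmod (f x))\<^sup>2)"
    by (intro Bochner_Integration.integrable_bound[OF integrable_mult_right[OF integrable_exp_abs[of "2 * b"], of "C\<^sup>2"]])
       auto
  then show ?thesis by (simp add: square_integrable_def)
qed

lemma square_integrable_poly: "square_integrable (\<lambda>x. poly p (of_real x))"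
proof -
  obtain C n where C: "\<And>x. cmod (poly p (of_real x)) \<le> C * exp (real n * \<bar>x\<bar>)"
    using poly_exp_bound[of p] by auto
  have "(\<lambda>x. poly p (complex_of_real x)) \<in> borel_measurable borel"
    by (intro borel_measurable_continuous_onI continuous_intros)
  then have "(\<lambda>x. poly p (complex_of_real x)) \<in> borel_measurable M"
    by simp
  then show ?thesis
    by (rule square_integrable_exp_bounded) (rule C)
qed

text \<open>
  The closure of the polynomials in $L_2(M)$.  The lemmas below say that it is a closed
  subspace and is stable under dominated pointwise limits; the remaining task is to show
  that it contains ever larger classes of functions.
\<close>

definition poly_limit :: "(real \<Rightarrow> complex) \<Rightarrow> bool" where
  "poly_limit f \<longleftrightarrow> square_integrable f \<and>
     (\<forall>\<epsilon>>0. \<exists>p :: complex poly. (\<integral>x. (cmod (f x - poly p (of_real x)))\<^sup>2 \<partial>M) < \<epsilon>)"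

lemma poly_limitD: "poly_limit f \<Longrightarrow> square_integrable f"
  by (simp add: poly_limit_def)

lemma poly_limit_poly: "poly_limit (\<lambda>x. poly p (of_real x))"
  by (auto simp: poly_limit_def square_integrable_poly intro!: exI[of _ p])

lemma poly_limit_closed:
  assumes f: "square_integrable f"
    and "\<And>\<epsilon>. \<epsilon> > 0 \<Longrightarrow> \<exists>g. poly_limit g \<and> (\<integral>x. (cmod (f x - g x))\<^sup>2 \<partial>M) < \<epsilon>"
  shows "poly_limit f"
  unfolding poly_limit_def
proof (intro conjI f allI impI)
  fix \<epsilon> :: real assume "\<epsilon> > 0"
  then obtain g where g: "poly_limit g" "(\<integral>x. (cmod (f x - g x))\<^sup>2 \<partial>M) < \<epsilon> / 4"
    using assms(2)[of "\<epsilon> / 4"] by auto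
  then obtain p where p: "(\<integral>x. (cmod (g x - poly p (of_real x)))\<^sup>2 \<partial>M) < \<epsilon> / 4"
    using \<open>\<epsilon> > 0\<close> unfolding poly_limit_def by (meson divide_pos_pos zero_less_numeral)
  have "(\<integral>x. (cmod ((f x - g x) + (g x - poly p (of_real x))))\<^sup>2 \<partial>M)
      \<le> 2 * (\<integral>x. (cmod (f x - g x))\<^sup>2 \<partial>M) + 2 * (\<integral>x. (cmod (g x - poly p (of_real x)))\<^sup>2 \<partial>M)"
    by (intro square_integrable_add square_integrable_diff f poly_limitD[OF g(1)] square_integrable_poly)
  also have "\<dots> < \<epsilon>" using g(2) p by simp
  finally show "\<exists>p. (\<integral>x. (cmod (f x - poly p (of_real x)))\<^sup>2 \<partial>M) < \<epsilon>"
    by (intro exI[of _ p]) simp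
qed

lemma poly_limit_add:
  assumes f: "poly_limit f" and g: "poly_limit g"
  shows "poly_limit (\<lambda>x. f x + g x)"
  unfolding poly_limit_def
proof (intro conjI square_integrable_add poly_limitD f g allI impI)
  fix \<epsilon> :: real assume "\<epsilon> > 0"
  then have "\<epsilon> / 4 > 0" by simp
  then obtain p q where p: "(\<integral>x. (cmod (f x - poly p (of_real x)))\<^sup>2 \<partial>M) < \<epsilon> / 4"
    and q: "(\<integral>x. (cmod (g x - poly q (of_real x)))\<^sup>2 \<partial>M) < \<epsilon> / 4"
    using f g unfolding poly_limit_def by meson
  have "(\<integral>x. (cmod ((f x - poly p (of_real x)) + (g x - poly q (of_real x))))\<^sup>2 \<partial>M)
      \<le> 2 * (\<integral>x. (cmod (f x - poly p (of_real x)))\<^sup>2 \<partial>M) + 2 * (\<integral>x. (cmod (g x - poly q (of_real x)))\<^sup>2 \<partial>M)"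
    by (intro square_integrable_add square_integrable_diff poly_limitD[OF f] poly_limitD[OF g] square_integrable_poly)
  also have "\<dots> < \<epsilon>" using p q by simp
  finally show "\<exists>p. (\<integral>x. (cmod (f x + g x - poly p (of_real x)))\<^sup>2 \<partial>M) < \<epsilon>"
    by (intro exI[of _ "p + q"]) (simp add: algebra_simps)
qed

lemma poly_limit_mult:
  assumes f: "poly_limit f"
  shows "poly_limit (\<lambda>x. c * f x)"
proof (cases "c = 0")
  case True
  then show ?thesis using poly_limit_poly[of 0] by simp
next
  case False
  show ?thesis
    unfolding poly_limit_def
  proof (intro conjI square_integrable_mult poly_limitD f allI impI)
    fix \<epsilon> :: real assume "\<epsilon> > 0"
    then have "\<epsilon> / (cmod c)\<^sup>2 > 0" using False by simp
    then obtain p where p: "(\<integral>x. (cmod (f x - poly p (of_real x)))\<^sup>2 \<partial>M) < \<epsilon> / (cmod c)\<^sup>2"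
      using f unfolding poly_limit_def by meson
    have "(\<integral>x. (cmod (c * f x - poly (smult c p) (of_real x)))\<^sup>2 \<partial>M)
        = (cmod c)\<^sup>2 * (\<integral>x. (cmod (f x - poly p (of_real x)))\<^sup>2 \<partial>M)"
      by (simp add: right_diff_distrib[symmetric] norm_mult power_mult_distrib)
    also have "\<dots> < \<epsilon>" using p False by (simp add: field_simps)
    finally show "\<exists>p. (\<integral>x. (cmod (c * f x - poly p (of_real x)))\<^sup>2 \<partial>M) < \<epsilon>"
      by blast
  qed
qed

lemma poly_limit_sum:
  assumes "\<And>i. i \<in> I \<Longrightarrow> poly_limit (f i)"
  shows "poly_limit (\<lambda>x. \<Sum>i\<in>I. f i x)"
  using assms
proof (induction I rule: infinite_finite_induct)
  case (insert i I)
  then show ?case by (simp add: poly_limit_add)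
qed (use poly_limit_poly[of 0] in auto)

lemma poly_limit_dominated:
  assumes lim: "\<And>n. poly_limit (F n)" and f [measurable]: "f \<in> borel_measurable M"
    and conv: "\<And>x. (\<lambda>n. F n x) \<longlonglongrightarrow> f x"
    and bound: "\<And>n x. cmod (F n x) \<le> w x" and w: "integrable M (\<lambda>x. (w x)\<^sup>2)"
    and [measurable]: "w \<in> borel_measurable M"
  shows "poly_limit f"
proof (rule poly_limit_closed)
  have [measurable]: "F n \<in> borel_measurable M" for n
    using poly_limitD[OF lim] by (simp add: square_integrable_def)
  have fw: "cmod (f x) \<le> w x" for x
    by (rule tendsto_upperbound[OF tendsto_norm[OF conv]]) (auto simp: bound)
  show "square_integrable f"
    unfolding square_integrable_def
    by (intro conjI f Bochner_Integration.integrable_bound[OF w] AE_I2) (auto simp: power_mono fw)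
  have L2: "(\<lambda>n. \<integral>x. (cmod (f x - F n x))\<^sup>2 \<partial>M) \<longlonglongrightarrow> (\<integral>x. 0 \<partial>M)"
  proof (rule integral_dominated_convergence)
    show "integrable M (\<lambda>x. 4 * (w x)\<^sup>2)" using w by simp
    show "AE x in M. (\<lambda>n. (cmod (f x - F n x))\<^sup>2) \<longlonglongrightarrow> 0"
    proof (rule AE_I2)
      fix x
      have "(\<lambda>n. (cmod (f x - F n x))\<^sup>2) \<longlonglongrightarrow> (cmod (f x - f x))\<^sup>2"
        by (intro tendsto_intros conv)
      then show "(\<lambda>n. (cmod (f x - F n x))\<^sup>2) \<longlonglongrightarrow> 0" by simp
    qed
    show "AE x in M. norm ((cmod (f x - F n x))\<^sup>2) \<le> 4 * (w x)\<^sup>2" for n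
    proof (rule AE_I2)
      fix x
      have "cmod (f x - F n x) \<le> 2 * w x"
        using norm_triangle_ineq4[of "f x" "F n x"] fw[of x] bound[of n x] by linarith
      from power_mono[OF this, of 2]
      show "norm ((cmod (f x - F n x))\<^sup>2) \<le> 4 * (w x)\<^sup>2" by (simp add: power_mult_distrib)
    qed
  qed simp_all
  show "\<exists>g. poly_limit g \<and> (\<integral>x. (cmod (f x - g x))\<^sup>2 \<partial>M) < \<epsilon>" if "\<epsilon> > 0" for \<epsilon>
    proof -
    have "eventually (\<lambda>n. (\<integral>x. (cmod (f x - F n x))\<^sup>2 \<partial>M) < \<epsilon>) sequentially"
      using order_tendstoD(2)[OF L2, of \<epsilon>] that by simp
    then show ?thesis
      using lim by (auto simp: eventually_sequentially)
  qed
qed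

text \<open>
  The partial sums of the power series of \<open>exp (\<i> a x)\<close> are polynomials dominated by
  \<open>exp (\<bar>a\<bar> * \<bar>x\<bar>)\<close>.  The bound is square integrable because $M$ has
  exponential moments; finiteness of all polynomial moments would not suffice for density.
\<close>

lemma poly_limit_cis: "poly_limit (\<lambda>x. cis (a * x))"
proof (rule poly_limit_dominated)
  let ?p = "\<lambda>n. \<Sum>k<n. monom ((\<i> * of_real a) ^ k / fact k) k :: complex poly"
  have eq: "poly (?p n) (of_real x) = (\<Sum>k<n. (\<i> * of_real (a * x)) ^ k /\<^sub>R fact k)" for n x
    by (auto simp: poly_sum poly_monom scaleR_conv_of_real field_simps power_mult_distrib intro!: sum.cong)
  show "poly_limit (\<lambda>x. poly (?p n) (of_real x))" for n
    by (rule poly_limit_poly)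
  show "(\<lambda>n. poly (?p n) (of_real x)) \<longlonglongrightarrow> cis (a * x)" for x
    using exp_converges[of "\<i> * of_real (a * x)"]
    unfolding eq sums_def cis_conv_exp by simp
  show "cmod (poly (?p n) (of_real x)) \<le> exp (\<bar>a\<bar> * \<bar>x\<bar>)" for n x
  proof -
    have "cmod (poly (?p n) (of_real x)) \<le> (\<Sum>k<n. \<bar>a * x\<bar> ^ k /\<^sub>R fact k)"
      unfolding eq by (rule sum_norm_le) (simp add: norm_mult norm_power norm_divide abs_mult)
    also have "\<dots> \<le> exp \<bar>a * x\<bar>"
      using sum_le_suminf[OF summable_exp_generic[of "\<bar>a * x\<bar>"], of "{..<n}"] by (simp add: exp_def)
    finally show ?thesis by (simp add: abs_mult)
  qed
  show "integrable M (\<lambda>x. (exp (\<bar>a\<bar> * \<bar>x\<bar>))\<^sup>2)"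
    using integrable_exp_abs[of "2 * \<bar>a\<bar>"] by (simp add: exp_double[symmetric] mult_ac)
  have "(\<lambda>x. cis (a * x)) \<in> borel_measurable borel"
    by (intro borel_measurable_continuous_onI continuous_intros)
  then show "(\<lambda>x. cis (a * x)) \<in> borel_measurable M" by simp
qed simp

text \<open>
  Euler's formula for the sine lowers the power by one and shifts the frequency \<open>b\<close> by \<open>a\<close> in both
  directions; the factor \<open>cis (b * x)\<close> absorbs this shift in the induction.
\<close>

lemma poly_limit_sin_power: "poly_limit (\<lambda>x. of_real (sin (a * x) ^ k) * cis (b * x))"
proof (induction k arbitrary: b)
  case 0
  then show ?case using poly_limit_cis by simp
next
  case (Suc k)
  have sin_cis: "of_real (sin y) = - \<i> / 2 * cis y + \<i> / 2 * cis (- y)" for y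
    by (simp add: complex_eq_iff)
  have "of_real (sin (a * x) ^ Suc k) * cis (b * x) =
      - \<i> / 2 * (of_real (sin (a * x) ^ k) * cis ((b + a) * x)) + \<i> / 2 * (of_real (sin (a * x) ^ k) * cis ((b - a) * x))"
    (is "?l x = ?r x") for x
  proof -
    have "?l x = of_real (sin (a * x) ^ k) * cis (b * x) * (- \<i> / 2 * cis (a * x) + \<i> / 2 * cis (- (a * x)))"
      unfolding sin_cis[symmetric] by (simp add: mult_ac)
    also have "\<dots> = - \<i> / 2 * (of_real (sin (a * x) ^ k) * (cis (b * x) * cis (a * x)))
        + \<i> / 2 * (of_real (sin (a * x) ^ k) * (cis (b * x) * cis (- (a * x))))"
      by (simp only: distrib_left mult_ac)
    also have "\<dots> = ?r x"
      by (simp only: cis_mult distrib_right left_diff_distrib diff_conv_add_uminus minus_mult_left)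
    finally show ?thesis .
  qed
  moreover have "poly_limit ?r"
    by (intro poly_limit_add poly_limit_mult Suc)
  ultimately show ?case by simp
qed

text \<open>
  For a fixed $n$ the function $s_n(x) = n \sin(x/n)$ has values in the compact interval $[-n,n]$, on
  which \<open>\<phi>\<close> is a uniform limit of polynomials $g$ by Weierstrass's theorem, and $g \circ s_n$ is a
  trigonometric polynomial.  Hence \<open>\<phi> \<circ> s\<^sub>n\<close> is in the closure.  As $s_n(x) \to x$, these functions
  converge to \<open>\<phi>\<close> pointwise and boundedly.  (The code uses \<open>Suc n\<close> for $n$ to stay away from $0$.)
\<close>

lemma poly_limit_bounded_continuous:
  fixes \<phi> :: "real \<Rightarrow> real"
  assumes cont: "continuous_on UNIV \<phi>" and B: "\<And>x. \<bar>\<phi> x\<bar> \<le> B"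
  shows "poly_limit (\<lambda>x. of_real (\<phi> x))"
proof (rule poly_limit_dominated)
  let ?s = "\<lambda>n x. real (Suc n) * sin (x / real (Suc n))"
  have [measurable]: "\<phi> \<in> borel_measurable borel"
    by (rule borel_measurable_continuous_onI[OF cont])
  show meas: "(\<lambda>x. complex_of_real (\<phi> x)) \<in> borel_measurable M" by simp
  show "poly_limit (\<lambda>x. of_real (\<phi> (?s n x)))" for n
  proof (rule poly_limit_closed)
    have [measurable]: "(\<lambda>x. \<phi> (?s n x)) \<in> borel_measurable M"
      by simp
    show "square_integrable (\<lambda>x. of_real (\<phi> (?s n x)))"
      by (rule square_integrable_bounded[of _ B]) (auto simp: B)
    fix \<epsilon> :: real assume "\<epsilon> > 0"
    \<comment> \<open>the added \<open>1\<close> keeps \<open>K\<close> positive when \<open>M\<close> is the null measure\<close>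
    define K where "K = measure M UNIV + 1"
    have "K > 0" by (simp add: K_def add_nonneg_pos)
    define d where "d = sqrt (\<epsilon> / K)"
    have "d > 0" "d\<^sup>2 = \<epsilon> / K" using \<open>\<epsilon> > 0\<close> \<open>K > 0\<close> by (auto simp: d_def)
    obtain g where "real_polynomial_function g"
      and g: "\<And>y. y \<in> {- real (Suc n)..real (Suc n)} \<Longrightarrow> \<bar>\<phi> y - g y\<bar> < d"
      using Stone_Weierstrass_real_polynomial_function[of "{- real (Suc n)..real (Suc n)}" \<phi> d]
        continuous_on_subset[OF cont] \<open>d > 0\<close> by auto
    then obtain c N where gc: "g = (\<lambda>y. \<Sum>i\<le>N. c i * y ^ i)"
      unfolding real_polynomial_function_iff_sum by auto
    have near: "(cmod (of_real (\<phi> (?s n x)) - of_real (g (?s n x))))\<^sup>2 \<le> d\<^sup>2" for x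
    proof -
      have "\<bar>?s n x\<bar> \<le> real (Suc n) * 1"
        unfolding abs_mult by (intro mult_mono) auto
      then have "?s n x \<in> {- real (Suc n)..real (Suc n)}"
        by (simp add: abs_le_iff del: of_nat_Suc)
      then have "\<bar>\<phi> (?s n x) - g (?s n x)\<bar> \<le> d" by (rule less_imp_le[OF g])
      then show ?thesis
        by (simp only: of_real_diff[symmetric] norm_of_real) (intro power_mono, auto)
    qed
    have lim: "poly_limit (\<lambda>x. of_real (g (?s n x)))"
    proof -
      have "poly_limit (\<lambda>x. \<Sum>i\<le>N. of_real (c i * real (Suc n) ^ i) * (of_real (sin (1 / real (Suc n) * x) ^ i) * cis (0 * x)))"
        by (intro poly_limit_sum poly_limit_mult poly_limit_sin_power)
      also have "(\<lambda>x. \<Sum>i\<le>N. of_real (c i * real (Suc n) ^ i) * (of_real (sin (1 / real (Suc n) * x) ^ i) * cis (0 * x)))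
         = (\<lambda>x. complex_of_real (g (?s n x)))"
        by (simp add: gc power_mult_distrib mult_ac del: of_nat_Suc)
      finally show ?thesis .
    qed
    have "(\<integral>x. (cmod (of_real (\<phi> (?s n x)) - of_real (g (?s n x))))\<^sup>2 \<partial>M) \<le> (\<integral>x. d\<^sup>2 \<partial>M)"
    proof (rule integral_mono)
      show "integrable M (\<lambda>x. (cmod (of_real (\<phi> (?s n x)) - of_real (g (?s n x))))\<^sup>2)"
        using square_integrable_diff[OF \<open>square_integrable (\<lambda>x. of_real (\<phi> (?s n x)))\<close> poly_limitD[OF lim]]
        by (simp add: square_integrable_def)
    qed (use near in auto)
    also have "\<dots> = measure M UNIV * (\<epsilon> / K)"
      by (simp add: \<open>d\<^sup>2 = \<epsilon> / K\<close>)
    also have "\<dots> < \<epsilon>"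
      using \<open>\<epsilon> > 0\<close> \<open>K > 0\<close> by (simp add: divide_simps) (simp add: K_def)
    finally show "\<exists>h. poly_limit h \<and> (\<integral>x. (cmod (of_real (\<phi> (?s n x)) - h x))\<^sup>2 \<partial>M) < \<epsilon>"
      using lim by blast
  qed
  show "(\<lambda>n. complex_of_real (\<phi> (?s n x))) \<longlonglongrightarrow> of_real (\<phi> x)" for x
  proof -
    have "(\<lambda>n. ?s n x) \<longlonglongrightarrow> x"
      by real_asymp
    then show ?thesis
      using cont by (intro tendsto_of_real isCont_tendsto_compose[of x \<phi>]) (auto simp: continuous_on_eq_continuous_at)
  qed
  show "cmod (of_real (\<phi> (?s n x))) \<le> B" for n x by (simp add: B)
qed simp_all

lemma poly_limit_indicator_atMost: "poly_limit (indicator {..a})"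
proof (rule poly_limit_dominated)
  \<comment> \<open>equal to \<open>1\<close> up to \<open>a\<close>, then descending to \<open>0\<close> with slope \<open>- n\<close>\<close>
  let ?\<phi> = "\<lambda>n x. max 0 (1 - real n * max 0 (x - a))"
  show "poly_limit (\<lambda>x. of_real (?\<phi> n x))" for n
    by (intro poly_limit_bounded_continuous[of _ 1] continuous_intros) (auto simp: max_def)
  show "(\<lambda>n. complex_of_real (?\<phi> n x)) \<longlonglongrightarrow> indicator {..a} x" for x
  proof (cases "x \<le> a")
    case False
    obtain N :: nat where N: "real N > 1 / (x - a)" using reals_Archimedean2 by blast
    have "?\<phi> n x = 0" if "n \<ge> N" for n
    proof -
      have "real n > 1 / (x - a)" using N that by linarith
      then show ?thesis using False by (simp add: field_simps max_def)
    qed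
    then have "eventually (\<lambda>n. complex_of_real (?\<phi> n x) = 0) sequentially"
      by (auto simp: eventually_sequentially)
    then show ?thesis using False by (simp add: tendsto_eventually)
  qed (simp add: max_def)
  show "cmod (of_real (?\<phi> n x)) \<le> 1" for n x by (auto simp: max_def)
qed simp_all

text \<open>
  The sets whose indicators lie in the closure form a Dynkin system, by stability under dominated
  limits, and it contains the half-lines, an intersection-stable generator of the Borel sets.
\<close>

lemma poly_limit_indicator:
  assumes "A \<in> sets borel"
  shows "poly_limit (indicator A)"
proof -
  have sb: "sets borel = sigma_sets UNIV (range (\<lambda>a::real. {..a}))"
    by (subst borel_eq_atMost) (auto intro!: sets_measure_of)
  have "Int_stable (range (\<lambda>a::real. {..a}))"
    by (auto simp: Int_stable_def)
  then show ?thesis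
    using subset_UNIV[of "range (\<lambda>a::real. {..a})", folded Pow_UNIV] assms[unfolded sb]
  proof (induction rule: sigma_sets_induct_disjoint)
    case (basic A)
    then show ?case using poly_limit_indicator_atMost by auto
  next
    case empty
    then show ?case using poly_limit_poly[of 0] by simp
  next
    case (compl A)
    have "poly_limit (\<lambda>x. poly 1 (of_real x) + (- 1) * indicator A x)"
      by (intro poly_limit_add poly_limit_mult poly_limit_poly compl)
    also have "(\<lambda>x. poly 1 (of_real x) + (- 1) * indicator A x) = indicator (UNIV - A)"
      by (auto simp: fun_eq_iff indicator_def)
    finally show ?case .
  next
    case (union A)
    show ?case
    proof (rule poly_limit_dominated)
      show "poly_limit (\<lambda>x. \<Sum>i<n. indicator (A i) x)" for n
        by (intro poly_limit_sum union)
      have eq: "(\<Sum>i<n. indicator (A i) x) = (indicator (\<Union>i<n. A i) x :: complex)" for n x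
        using union(1) by (subst indicator_UN_disjoint) (auto simp: disjoint_family_on_def)
      show "(\<lambda>n. \<Sum>i<n. indicator (A i) x) \<longlonglongrightarrow> (indicator (\<Union>i. A i) x :: complex)" for x
        unfolding eq by (rule LIMSEQ_indicator_UN)
      show "cmod (\<Sum>i<n. indicator (A i) x) \<le> 1" for n x
        unfolding eq by (simp add: indicator_def)
      have "(\<Union>i. A i) \<in> sets borel" using union(2) unfolding sb[symmetric] by auto
      then show "indicator (\<Union>i. A i) \<in> borel_measurable M" by simp
    qed simp_all
  qed
qed

text \<open>
  The polynomials are dense in $L_2(M)$: simple functions are in the closure by the previous lemma,
  and every function is a pointwise limit of simple functions dominated by twice its modulus.
\<close>

theorem poly_limit_square_integrable:
  assumes "square_integrable f"
  shows "poly_limit f"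
proof -
  have [measurable]: "f \<in> borel_measurable M" and int: "integrable M (\<lambda>x. (cmod (f x))\<^sup>2)"
    using assms by (auto simp: square_integrable_def)
  obtain F where F: "\<And>i. simple_function M (F i)" "\<And>x. (\<lambda>i. F i x) \<longlonglongrightarrow> f x"
    "\<And>i x. cmod (F i x) \<le> 2 * cmod (f x)"
    using borel_measurable_implies_sequence_metric[of f M 0] by (auto simp: dist_norm)
  show ?thesis
  proof (rule poly_limit_dominated)
    show "poly_limit (F n)" for n
    proof -
      have "poly_limit (\<lambda>x. \<Sum>y \<in> range (F n). y * indicator (F n -` {y}) x)"
        using simple_functionD(2)[OF F(1)]
        by (intro poly_limit_sum poly_limit_mult poly_limit_indicator) auto
      also have "(\<lambda>x. \<Sum>y \<in> range (F n). y * indicator (F n -` {y}) x) = F n"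
        proof
        fix x
        show "(\<Sum>y \<in> range (F n). y * indicator (F n -` {y}) x) = F n x"
          using simple_functionD(1)[OF F(1)[of n]] by (subst sum.remove[of _ "F n x"]) (auto simp: indicator_def)
      qed
      finally show ?thesis .
    qed
    show "integrable M (\<lambda>x. (2 * cmod (f x))\<^sup>2)" using int by (simp add: power_mult_distrib)
  qed (use F in auto)
qed

end

section \<open>Hermite polynomials and their orthogonality\<close>

text \<open>
  The Hermite polynomials through their three-term recurrence, which is easier to use in algebra
  than the explicit sum; \<open>poly_hermite_poly\<close> below identifies the two.
\<close>

fun hermite_poly :: "nat \<Rightarrow> real poly" where
  "hermite_poly 0 = 1"
| "hermite_poly (Suc 0) = [:0, 2:]"
| "hermite_poly (Suc (Suc m)) = [:0, 2:] * hermite_poly (Suc m) - smult (2 * real (Suc m)) (hermite_poly m)"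

text \<open>
  The $k$-th summand of \<open>hermite m t / fact m\<close>, extended by zero so that the upper bound of the
  sum no longer depends on \<open>m\<close>; otherwise the parity of \<open>m\<close> would enter the recurrence.
\<close>

definition hermite_term :: "nat \<Rightarrow> real \<Rightarrow> nat \<Rightarrow> real" where
  "hermite_term m t k =
     (if 2 * k \<le> m then (-1) ^ k / (fact k * fact (m - 2 * k)) * (2 * t) ^ (m - 2 * k) else 0)"

lemma hermite_eq_sum_terms:
  assumes "m div 2 \<le> N"
  shows "hermite m t = fact m * (\<Sum>k\<le>N. hermite_term m t k)"
proof -
  have "(\<Sum>k\<le>N. hermite_term m t k) = (\<Sum>k\<in>{0..m div 2}. hermite_term m t k)"
    using assms by (intro sum.mono_neutral_right) (auto simp: hermite_term_def)
  also have "\<dots> = (\<Sum>k = 0..m div 2. (-1) ^ k / (fact k * fact (m - 2 * k)) * (2 * t) ^ (m - 2 * k))"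
    by (intro sum.cong) (auto simp: hermite_term_def)
  finally show ?thesis by (simp add: hermite_def)
qed

text \<open>
  The recurrence holds term by term.  With $j = m + 2 - 2k$, write the factor $m + 2$ as $j + 2k$: in
  \<open>hermite_term (m + 2) t k\<close> the part $j$ lowers the exponent of \<open>2 * t\<close> by one, and
  the part $2k$ lowers \<open>k\<close> by one.
\<close>

lemma hermite_term_0:
  "real (Suc (Suc m)) * hermite_term (Suc (Suc m)) t 0 = 2 * t * hermite_term (Suc m) t 0"
  unfolding hermite_term_def
  by (simp add: fact_Suc[of "Suc m"] power_Suc[of _ "Suc m"] del: of_nat_Suc fact_Suc power_Suc)

lemma hermite_term_Suc:
  "real (Suc (Suc m)) * hermite_term (Suc (Suc m)) t (Suc k) =
     2 * t * hermite_term (Suc m) t (Suc k) - 2 * hermite_term m t k"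
proof (cases "2 * k < m")
  case True
  then obtain j where m: "m = Suc (2 * k + j)" by (metis less_imp_Suc_add)
  have *: "Suc (Suc m) - 2 * Suc k = Suc j" "Suc m - 2 * Suc k = j" "m - 2 * k = Suc j"
    using m by auto
  show ?thesis
    unfolding hermite_term_def * using m by (simp add: divide_simps) (simp add: algebra_simps)
next
  case False
  show ?thesis
  proof (cases "m = 2 * k")
    case True
    then have "real (Suc (Suc m)) = 2 * real (Suc k)" by simp
    then show ?thesis
      by (simp add: True hermite_term_def fact_Suc[of k] divide_simps del: of_nat_Suc fact_Suc)
  qed (use False in \<open>simp add: hermite_term_def\<close>)
qed

lemma hermite_recurrence:
  "hermite (Suc (Suc m)) t = 2 * t * hermite (Suc m) t - 2 * real (Suc m) * hermite m t"
proof -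
  have "real (Suc (Suc m)) * (\<Sum>k\<le>Suc m. hermite_term (Suc (Suc m)) t k) =
      real (Suc (Suc m)) * hermite_term (Suc (Suc m)) t 0
      + (\<Sum>k\<le>m. real (Suc (Suc m)) * hermite_term (Suc (Suc m)) t (Suc k))"
    unfolding sum.atMost_Suc_shift by (simp only: sum_distrib_left distrib_left)
  also have "\<dots> = 2 * t * (\<Sum>k\<le>Suc m. hermite_term (Suc m) t k) - 2 * (\<Sum>k\<le>m. hermite_term m t k)"
    unfolding hermite_term_0 hermite_term_Suc sum.atMost_Suc_shift
    by (simp add: sum_distrib_left distrib_left sum_subtractf)
  finally have "fact (Suc m) * (real (Suc (Suc m)) * (\<Sum>k\<le>Suc m. hermite_term (Suc (Suc m)) t k)) =
      fact (Suc m) * (2 * t * (\<Sum>k\<le>Suc m. hermite_term (Suc m) t k) - 2 * (\<Sum>k\<le>m. hermite_term m t k))"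
    by simp
  then show ?thesis
    using hermite_eq_sum_terms[of "Suc (Suc m)" "Suc m" t] hermite_eq_sum_terms[of "Suc m" "Suc m" t]
      hermite_eq_sum_terms[of m m t]
    by (simp add: algebra_simps del: sum.atMost_Suc)
qed

lemma poly_hermite_poly: "poly (hermite_poly m) t = hermite m t"
proof (induction m rule: hermite_poly.induct)
  case (3 m)
  then show ?case by (simp add: hermite_recurrence)
qed (simp_all add: hermite_def)

lemma pderiv_hermite_poly:
  "pderiv (hermite_poly (Suc m)) = smult (2 * real (Suc m)) (hermite_poly m)"
proof (induction m rule: hermite_poly.induct)
  case (3 m)
  have d: "pderiv [:0, 2 :: real:] = [:2:]" by (simp add: pderiv_pCons)
  show ?case
    unfolding hermite_poly.simps(3)[of "Suc m"] pderiv_diff pderiv_mult pderiv_smult 3 d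
    by (rule poly_ext) (simp add: algebra_simps)
qed (simp_all add: pderiv_pCons pderiv_mult one_pCons pderiv_diff)

text \<open>
  Multiplied by the weight $e^{-u^2}$, this reads $H_{m+1} e^{-u^2} = -(H_m e^{-u^2})'$; this is the form of the
  recurrence that suits integration by parts.
\<close>

lemma hermite_poly_Suc:
  "hermite_poly (Suc m) = [:0, 2:] * hermite_poly m - pderiv (hermite_poly m)"
  by (cases m) (simp_all add: pderiv_hermite_poly)

text \<open>
  The expectation of a polynomial under the normal law whose density is $e^{-u^2}/\sqrt\pi$,
  the weight for which the physicist's Hermite polynomials are orthogonal.
\<close>

definition gauss_mean :: "real poly \<Rightarrow> real" where
  "gauss_mean p = (\<integral>x. normal_density 0 (1 / sqrt 2) x * poly p x \<partial>lborel)"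

lemma integrable_normal_poly:
  assumes "\<sigma> > 0"
  shows "integrable lborel (\<lambda>x. normal_density 0 \<sigma> x * poly p x)"
  unfolding poly_altdef sum_distrib_left
  using integrable_normal_moment[OF assms, of 0]
  by (intro Bochner_Integration.integrable_sum) (auto simp: mult.left_commute[of _ "coeff _ _"])

lemma gauss_mean_add: "gauss_mean (p + q) = gauss_mean p + gauss_mean q"
  by (simp add: gauss_mean_def distrib_left integrable_normal_poly)

lemma gauss_mean_diff: "gauss_mean (p - q) = gauss_mean p - gauss_mean q"
  by (simp add: gauss_mean_def right_diff_distrib integrable_normal_poly)

lemma gauss_mean_smult: "gauss_mean (smult c p) = c * gauss_mean p"
  by (simp add: gauss_mean_def mult.left_commute[of _ c])

lemma gauss_mean_1: "gauss_mean 1 = 1"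
  by (simp add: gauss_mean_def)

lemma gauss_mean_0: "gauss_mean 0 = 0"
  by (simp add: gauss_mean_def)

lemma gauss_mean_monom_even: "gauss_mean (monom 1 (2 * k)) = fact (2 * k) / (4 ^ k * fact k)"
  using integral_normal_moment_even[of "1 / sqrt 2" 0 k]
  by (simp add: gauss_mean_def poly_monom power_divide)

lemma gauss_mean_monom_odd: "gauss_mean (monom 1 (2 * k + 1)) = 0"
  using integral_normal_moment_odd[of "1 / sqrt 2" 0 k]
  by (simp add: gauss_mean_def poly_monom)

text \<open>
  This is integration by parts against the weight $e^{-u^2}$.  Both sides are linear in \<open>p\<close>, so it
  suffices to compare the known moments of the normal law.
\<close>

lemma stein_identity: "gauss_mean ([:0, 2:] * p) = gauss_mean (pderiv p)"
proof -
  have monom: "gauss_mean ([:0, 2:] * monom c n) = gauss_mean (pderiv (monom c n))" for c n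
  proof -
    have l: "[:0, 2:] * monom c n = smult (2 * c) (monom 1 (Suc n))"
      by (simp add: monom_Suc smult_monom mult.commute)
    have r: "pderiv (monom c n) = smult (c * real n) (monom 1 (n - 1))"
      by (simp add: pderiv_monom smult_monom)
    show ?thesis
    proof (cases "even n")
      case True
      then obtain k where n: "n = 2 * k" by blast
      show ?thesis
      proof (cases k)
        case 0
        then show ?thesis using gauss_mean_monom_odd[of 0] n unfolding l r gauss_mean_smult by simp
      next
        case (Suc i)
        then have "Suc n = 2 * k + 1" "n - 1 = 2 * i + 1" using n by auto
        then show ?thesis unfolding l r gauss_mean_smult by (simp only: gauss_mean_monom_odd)
      qed
    next
      case False
      then obtain k where n: "n = 2 * k + 1" by (blast elim: oddE)
      then have "Suc n = 2 * Suc k" "n - 1 = 2 * k" by auto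
      moreover have "fact (2 * Suc k) / (4 ^ Suc k * fact (Suc k)) =
          real n / 2 * (fact (2 * k) / (4 ^ k * fact k) :: real)"
      proof -
        have "fact (2 * Suc k) = 2 * real (Suc k) * (real n * fact (2 * k))" by (simp add: n)
        then show ?thesis by (simp add: fact_Suc[of k] divide_simps del: of_nat_Suc fact_Suc)
      qed
      ultimately show ?thesis
        unfolding l r gauss_mean_smult by (simp only: gauss_mean_monom_even) simp
    qed
  qed
  have "gauss_mean ([:0, 2:] * (\<Sum>i\<in>I. monom (coeff p i) i)) = gauss_mean (pderiv (\<Sum>i\<in>I. monom (coeff p i) i))"
    if "finite I" for I
    using that
  proof (induction I)
    case empty
    show ?case by simp
  next
    case (insert i I)
    show ?case
      unfolding sum.insert[OF insert.hyps] pderiv_add distrib_left gauss_mean_add monom insert.IH ..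
  qed
  from this[of "{..degree p}"] show ?thesis
    by (simp only: poly_as_sum_of_monoms finite_atMost)
qed

text \<open>
  The passage from $H_m$ to $H_{m+1}$ is adjoint to differentiation.  Iterating this, the pairing of $H_m$
  with a polynomial $p$ is the mean of the $m$-th derivative of $p$.
\<close>

lemma gauss_mean_hermite_Suc:
  "gauss_mean (hermite_poly (Suc m) * p) = gauss_mean (hermite_poly m * pderiv p)"
proof -
  have "hermite_poly (Suc m) * p = [:0, 2:] * (hermite_poly m * p) - pderiv (hermite_poly m) * p"
    by (simp add: hermite_poly_Suc algebra_simps)
  then have "gauss_mean (hermite_poly (Suc m) * p) =
      gauss_mean (pderiv (hermite_poly m * p)) - gauss_mean (pderiv (hermite_poly m) * p)"
    by (simp only: gauss_mean_diff stein_identity)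
  also have "\<dots> = gauss_mean (hermite_poly m * pderiv p)"
    by (simp add: pderiv_mult gauss_mean_add mult.commute)
  finally show ?thesis .
qed

lemma gauss_mean_hermite_hermite:
  "gauss_mean (hermite_poly m * hermite_poly n) = (if m = n then 2 ^ m * fact m else 0)"
proof (induction m arbitrary: n)
  case 0
  show ?case
  proof (cases n)
    case (Suc k)
    then show ?thesis
      using gauss_mean_hermite_Suc[of k 1] by (simp add: gauss_mean_0)
  qed (simp add: gauss_mean_1)
next
  case (Suc m)
  show ?case
  proof (cases n)
    case 0
    then show ?thesis using gauss_mean_hermite_Suc[of m 1] by (simp add: gauss_mean_0)
  next
    case (Suc k)
    then show ?thesis
      by (simp add: gauss_mean_hermite_Suc pderiv_hermite_poly gauss_mean_smult Suc.IH del: of_nat_Suc)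
  qed
qed

section \<open>The span of the Hermite polynomials\<close>

definition hermite_combination :: "(real \<Rightarrow> complex) \<Rightarrow> bool" where
  "hermite_combination F \<longleftrightarrow> (\<exists>N c. \<forall>u. F u = (\<Sum>m<N. c m * of_real (hermite m u)))"

lemma hermite_combination_hermite: "hermite_combination (\<lambda>u. of_real (hermite m u))"
  unfolding hermite_combination_def
  by (intro exI[of _ "Suc m"] exI[of _ "\<lambda>i. if i = m then 1 else 0"]) simp

lemma hermite_combination_mult:
  assumes "hermite_combination F"
  shows "hermite_combination (\<lambda>u. a * F u)"
proof -
  obtain N c where "\<And>u. F u = (\<Sum>m<N. c m * of_real (hermite m u))"
    using assms unfolding hermite_combination_def by blast
  then show ?thesis
    unfolding hermite_combination_def
    by (intro exI[of _ N] exI[of _ "\<lambda>m. a * c m"]) (simp add: sum_distrib_left mult.assoc)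
qed

lemma hermite_combination_add:
  assumes "hermite_combination F" "hermite_combination G"
  shows "hermite_combination (\<lambda>u. F u + G u)"
proof -
  obtain N c N' c' where F: "\<And>u. F u = (\<Sum>m<N. c m * of_real (hermite m u))"
    and G: "\<And>u. G u = (\<Sum>m<N'. c' m * of_real (hermite m u))"
    using assms unfolding hermite_combination_def by blast
  have pad: "(\<Sum>m<K. d m * of_real (hermite m u)) =
      (\<Sum>m<max N N'. (if m < K then d m else 0) * of_real (hermite m u))"
    if "K \<le> max N N'" for K d u
    using that by (intro sum.mono_neutral_cong_left) auto
  show ?thesis
    unfolding hermite_combination_def
    by (intro exI[of _ "max N N'"]
          exI[of _ "\<lambda>m. (if m < N then c m else 0) + (if m < N' then c' m else 0)"])
       (simp add: F G pad[of N] pad[of N'] sum.distrib distrib_right)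
qed

lemma hermite_combination_sum:
  assumes "\<And>i. i \<in> I \<Longrightarrow> hermite_combination (F i)"
  shows "hermite_combination (\<lambda>u. \<Sum>i\<in>I. F i u)"
  using assms
proof (induction I rule: infinite_finite_induct)
  case (insert i I)
  then show ?case by (simp add: hermite_combination_add)
qed (use hermite_combination_mult[OF hermite_combination_hermite, of 0] in auto)

text \<open>
  The truncated subtraction \<open>m - 1\<close> is harmless at \<open>m = 0\<close>, where its coefficient vanishes.
\<close>

lemma times_hermite: "t * hermite m t = 1 / 2 * hermite (Suc m) t + real m * hermite (m - 1) t"
proof (cases m)
  case 0
  then show ?thesis by (simp add: hermite_def)
next
  case (Suc k)
  then show ?thesis using hermite_recurrence[of k t] by (simp add: algebra_simps)
qed

text \<open>
  Multiplication by the variable is a tridiagonal operator in the Hermite polynomials, so their span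
  is stable under it.  As the span contains the constants, it consists of all polynomials.
\<close>

lemma hermite_combination_times:
  assumes "hermite_combination F"
  shows "hermite_combination (\<lambda>u. of_real u * F u)"
proof -
  obtain N c where F: "\<And>u. F u = (\<Sum>m<N. c m * of_real (hermite m u))"
    using assms unfolding hermite_combination_def by blast
  have "of_real u * F u =
      (\<Sum>m<N. c m * (1 / 2 * of_real (hermite (Suc m) u) + of_real (real m) * of_real (hermite (m - 1) u)))" for u
  proof -
    have "of_real u * F u = (\<Sum>m<N. c m * of_real (u * hermite m u))"
      by (simp add: F sum_distrib_left mult_ac)
    then show ?thesis by (simp add: times_hermite)
  qed
  moreover have "hermite_combination (\<lambda>u. \<Sum>m<N. c m * (1 / 2 * of_real (hermite (Suc m) u)
      + of_real (real m) * of_real (hermite (m - 1) u)))"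
    by (intro hermite_combination_sum hermite_combination_mult hermite_combination_add hermite_combination_hermite)
  ultimately show ?thesis by simp
qed

lemma hermite_combination_poly: "hermite_combination (\<lambda>u. poly p (of_real (s * u)))" for p :: "complex poly"
proof (induction p)
  case 0
  then show ?case using hermite_combination_mult[OF hermite_combination_hermite, of 0] by simp
next
  case (pCons a p)
  have "hermite_combination (\<lambda>u. a * of_real (hermite 0 u) + of_real s * (of_real u * poly p (of_real (s * u))))"
    by (intro hermite_combination_add hermite_combination_mult hermite_combination_times
        hermite_combination_hermite pCons)
  then show ?case by (simp add: hermite_def mult.assoc)
qed

section \<open>The weighted space and the normal law\<close>

lemma borel_measurable_poly [measurable]:
  "poly p \<in> borel_measurable borel" for p :: "'a :: real_normed_field poly"
  by (intro borel_measurable_continuous_onI continuous_intros)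

lemma borel_measurable_cnj [measurable]: "cnj \<in> borel_measurable borel"
  by (intro borel_measurable_continuous_onI continuous_intros)

text \<open>
  Completing the square turns the exponentially tilted density into a multiple of a shifted one.
\<close>

lemma exponential_moments_normal:
  assumes "\<sigma> > 0"
  shows "exponential_moments (density lborel (normal_density 0 \<sigma>))"
proof
  fix a :: real
  have "normal_density 0 \<sigma> x * exp (a * x) = exp (a\<^sup>2 * \<sigma>\<^sup>2 / 2) * normal_density (a * \<sigma>\<^sup>2) \<sigma> x" for x
  proof -
    have "- x\<^sup>2 / (2 * \<sigma>\<^sup>2) + a * x = a\<^sup>2 * \<sigma>\<^sup>2 / 2 - (x - a * \<sigma>\<^sup>2)\<^sup>2 / (2 * \<sigma>\<^sup>2)"
      using assms by (simp add: field_simps power2_eq_square)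
    then show ?thesis
      by (simp add: normal_density_def exp_add[symmetric])
  qed
  then show "integrable (density lborel (normal_density 0 \<sigma>)) (\<lambda>x. exp (a * x))"
    using assms by (subst integrable_density) (auto simp: normal_density_nonneg integrable_normal_density)
qed simp

text \<open>
  The basis function with $m = 0$, which every basis function has as a factor.
\<close>

definition ground_state :: "real \<Rightarrow> real" where
  "ground_state t = 2 powr (1 / 4) * exp (- (t\<^sup>2 / 3))"

lemma ground_state_pos: "ground_state t > 0"
  by (simp add: ground_state_def)

lemma borel_measurable_ground_state [measurable]: "ground_state \<in> borel_measurable borel"
  unfolding ground_state_def by measurable

lemma borel_measurable_weight [measurable]: "weight \<alpha> \<in> borel_measurable borel"
  unfolding weight_def by measurable

text \<open>
  This identity makes multiplication by the ground state an isometry from the $L_2$ space of the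
  centred normal law of variance $3/8$ onto the weighted space: the weight contributes
  $e^{-2t^2/3}$ and the squared ground state another $e^{-2t^2/3}$, and the constants are
  those of the normal density.
\<close>

lemma ground_state_weight:
  "(ground_state t)\<^sup>2 * weight (sqrt (2 / 3)) t = normal_density 0 (sqrt (3 / 8)) t"
proof -
  have "(ground_state t)\<^sup>2 * weight (sqrt (2 / 3)) t =
      (2 powr (1 / 4))\<^sup>2 * (sqrt (2 / 3) / sqrt pi) * ((exp (- (t\<^sup>2 / 3)))\<^sup>2 * exp (- (2 / 3 * t\<^sup>2)))"
    by (simp add: ground_state_def weight_def power_mult_distrib)
  also have "(2 powr (1 / 4))\<^sup>2 = sqrt (2 :: real)"
    by (simp add: powr_half_sqrt[symmetric] power2_eq_square powr_add[symmetric])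
  also have "sqrt 2 * (sqrt (2 / 3) / sqrt pi) = 1 / sqrt (2 * pi * (3 / 8))"
    by (simp add: real_sqrt_mult[symmetric] real_sqrt_divide[symmetric] del: real_sqrt_mult real_sqrt_divide)
       (simp add: real_sqrt_divide real_sqrt_mult field_simps)
  also have "(exp (- (t\<^sup>2 / 3)))\<^sup>2 * exp (- (2 / 3 * t\<^sup>2)) = exp (- (t\<^sup>2 * 4 / 3))"
    by (simp add: exp_double[symmetric] exp_add[symmetric])
  also have "1 / sqrt (2 * pi * (3 / 8)) * exp (- (t\<^sup>2 * 4 / 3)) = normal_density 0 (sqrt (3 / 8)) t"
    by (simp add: normal_density_def mult_ac)
  finally show ?thesis .
qed

abbreviation gaussian :: "real measure" where
  "gaussian \<equiv> density lborel (normal_density 0 (sqrt (3 / 8)))"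

interpretation gaussian: exponential_moments gaussian
  by (rule exponential_moments_normal) simp

lemma L2w_inner_ground_state:
  assumes [measurable]: "F \<in> borel_measurable borel" "G \<in> borel_measurable borel"
  shows "L2w_inner (sqrt (2 / 3)) (\<lambda>t. of_real (ground_state t) * F t) (\<lambda>t. of_real (ground_state t) * G t) =
           (\<integral>t. cnj (F t) * G t \<partial>gaussian)"
proof -
  have "L2w_inner (sqrt (2 / 3)) (\<lambda>t. of_real (ground_state t) * F t) (\<lambda>t. of_real (ground_state t) * G t) =
      (LINT t|lebesgue. normal_density 0 (sqrt (3 / 8)) t *\<^sub>R (cnj (F t) * G t))"
    unfolding L2w_inner_def ground_state_weight[symmetric]
    by (simp add: scaleR_conv_of_real power2_eq_square mult_ac)
  also have "\<dots> = (\<integral>t. normal_density 0 (sqrt (3 / 8)) t *\<^sub>R (cnj (F t) * G t) \<partial>lborel)"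
    by (rule integral_completion) simp
  also have "\<dots> = (\<integral>t. cnj (F t) * G t \<partial>gaussian)"
    by (subst integral_density) (auto simp: normal_density_nonneg)
  finally show ?thesis .
qed

lemma L2w_norm_ground_state:
  assumes "F \<in> borel_measurable borel"
  shows "L2w_norm (sqrt (2 / 3)) (\<lambda>t. of_real (ground_state t) * F t) = sqrt (\<integral>t. (cmod (F t))\<^sup>2 \<partial>gaussian)"
proof -
  have "cnj z * z = of_real ((cmod z)\<^sup>2)" for z
    using complex_norm_square[of z] by (simp add: mult.commute)
  then show ?thesis
    unfolding L2w_norm_def L2w_inner_ground_state[OF assms assms] by (simp del: of_real_power)
qed

lemma ground_state_mult_in_L2w_iff:
  assumes [measurable]: "F \<in> borel_measurable borel"
  shows "(\<lambda>t. of_real (ground_state t) * F t) \<in> L2w (sqrt (2 / 3)) \<longleftrightarrow> gaussian.square_integrable F"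
proof -
  have "(\<lambda>t. (cmod (of_real (ground_state t) * F t))\<^sup>2 * weight (sqrt (2 / 3)) t) =
      (\<lambda>t. normal_density 0 (sqrt (3 / 8)) t *\<^sub>R (cmod (F t))\<^sup>2)"
    unfolding ground_state_weight[symmetric] by (simp add: fun_eq_iff norm_mult power_mult_distrib mult_ac)
  then show ?thesis
    unfolding L2w_def gaussian.square_integrable_def
    by (auto simp: integrable_completion integrable_density normal_density_nonneg intro: measurable_completion)
qed

text \<open>
  Elements of the weighted space are only Lebesgue measurable, whereas the density theorem concerns
  Borel functions; a change on a null set, invisible to the norm, bridges the gap.
\<close>

lemma complex_lebesgue_borel_version:
  fixes f :: "real \<Rightarrow> complex"
  assumes [measurable]: "f \<in> borel_measurable lebesgue"
  obtains g where "g \<in> borel_measurable borel" "AE t in lebesgue. f t = g t"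
proof -
  obtain r s where r: "r \<in> borel_measurable lborel" "AE t in lborel. Re (f t) = r t"
    and s: "s \<in> borel_measurable lborel" "AE t in lborel. Im (f t) = s t"
    using completion_ex_borel_measurable_real[of "\<lambda>t. Re (f t)" lborel]
      completion_ex_borel_measurable_real[of "\<lambda>t. Im (f t)" lborel] by auto
  show thesis
  proof
    show "(\<lambda>t. Complex (r t) (s t)) \<in> borel_measurable borel"
      using r(1) s(1) by (simp add: Complex_eq)
    have "AE t in lborel. f t = Complex (r t) (s t)"
      using r(2) s(2) by eventually_elim (simp add: complex_eq_iff)
    then show "AE t in lebesgue. f t = Complex (r t) (s t)" by (rule AE_completion)
  qed
qed

lemma L2w_cong_AE:
  assumes f: "f \<in> L2w \<alpha>" and g: "g \<in> borel_measurable borel" and ae: "AE t in lebesgue. f t = g t"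
  shows "g \<in> L2w \<alpha>"
proof -
  have [measurable]: "f \<in> borel_measurable lebesgue" "g \<in> borel_measurable lebesgue"
    "weight \<alpha> \<in> borel_measurable lebesgue"
    using f g by (auto simp: L2w_def intro: measurable_completion)
  have "integrable lebesgue (\<lambda>t. (cmod (g t))\<^sup>2 * weight \<alpha> t) = integrable lebesgue (\<lambda>t. (cmod (f t))\<^sup>2 * weight \<alpha> t)"
    using ae by (intro integrable_cong_AE) auto
  then show ?thesis using f by (simp add: L2w_def)
qed

lemma L2w_norm_cong_AE:
  assumes [measurable]: "f \<in> borel_measurable lebesgue" "g \<in> borel_measurable lebesgue"
    and ae: "AE t in lebesgue. f t = g t"
  shows "L2w_norm \<alpha> f = L2w_norm \<alpha> g"
proof -
  have [measurable]: "weight \<alpha> \<in> borel_measurable lebesgue"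
    by (auto intro: measurable_completion)
  have "(\<lambda>t. cnj (f t) * f t * of_real (weight \<alpha> t)) \<in> borel_measurable lebesgue"
    "(\<lambda>t. cnj (g t) * g t * of_real (weight \<alpha> t)) \<in> borel_measurable lebesgue"
    by measurable
  then have "L2w_inner \<alpha> f f = L2w_inner \<alpha> g g"
    unfolding L2w_inner_def using ae by (intro integral_cong_AE) auto
  then show ?thesis by (simp add: L2w_norm_def)
qed

text \<open>
  If $t$ is normal with variance $3/8$, then $u = 2t/\sqrt3$ has variance $1/2$.
\<close>

lemma gaussian_integral_scaled_poly:
  "(\<integral>t. poly p (2 * t / sqrt 3) \<partial>gaussian) = gauss_mean p"
proof -
  have "(\<integral>t. poly p (2 * t / sqrt 3) \<partial>gaussian) =
      (\<integral>t. normal_density 0 (sqrt (3 / 8)) t * poly p (2 * t / sqrt 3) \<partial>lborel)"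
    by (subst integral_density) (auto simp: normal_density_nonneg)
  also have "\<dots> = (sqrt 3 / 2) * (\<integral>u. normal_density 0 (sqrt (3 / 8)) (sqrt 3 / 2 * u) * poly p u \<partial>lborel)"
    by (subst lborel_integral_real_affine[of "sqrt 3 / 2" _ 0]) auto
  also have "\<dots> = (\<integral>u. (sqrt 3 / 2) * (normal_density 0 (sqrt (3 / 8)) (sqrt 3 / 2 * u) * poly p u) \<partial>lborel)"
    by simp
  also have "\<dots> = gauss_mean p"
  proof -
    have "(sqrt 3 / 2) * normal_density 0 (sqrt (3 / 8)) (sqrt 3 / 2 * u) = normal_density 0 (1 / sqrt 2) u" for u
      by (simp add: normal_density_def power_mult_distrib power_divide real_sqrt_mult real_sqrt_divide field_simps)
    then show ?thesis by (simp add: gauss_mean_def mult.assoc[symmetric])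
  qed
  finally show ?thesis .
qed

section \<open>The orthonormal basis\<close>

definition normalized_hermite :: "nat \<Rightarrow> real \<Rightarrow> real" where
  "normalized_hermite m t = sqrt (1 / (2 ^ m * fact m)) * hermite m (2 * t / sqrt 3)"

lemma continuous_on_hermite [continuous_intros]: "continuous_on A f \<Longrightarrow> continuous_on A (\<lambda>t. hermite m (f t))"
  unfolding poly_hermite_poly[symmetric] by (intro continuous_intros)

lemma borel_measurable_hermite [measurable]: "hermite m \<in> borel_measurable borel"
  by (intro borel_measurable_continuous_onI continuous_intros)

lemma borel_measurable_normalized_hermite [measurable]: "normalized_hermite m \<in> borel_measurable borel"
  unfolding normalized_hermite_def by measurable

lemma gaussian_normalized_hermite:
  "(\<integral>t. normalized_hermite m t * normalized_hermite n t \<partial>gaussian) = (if m = n then 1 else 0)"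
proof -
  let ?s = "sqrt (1 / (2 ^ m * fact m)) * sqrt (1 / (2 ^ n * fact n))"
  have "(\<integral>t. normalized_hermite m t * normalized_hermite n t \<partial>gaussian) =
      (\<integral>t. ?s * poly (hermite_poly m * hermite_poly n) (2 * t / sqrt 3) \<partial>gaussian)"
    by (simp add: normalized_hermite_def poly_hermite_poly mult_ac)
  also have "\<dots> = ?s * gauss_mean (hermite_poly m * hermite_poly n)"
    by (simp only: integral_mult_right_zero gaussian_integral_scaled_poly)
  also have "\<dots> = (if m = n then 1 else 0)"
    by (simp add: gauss_mean_hermite_hermite real_sqrt_mult_self)
  finally show ?thesis .
qed

lemma square_integrable_normalized_hermite:
  "gaussian.square_integrable (\<lambda>t. of_real (normalized_hermite m t))"
proof -
  have "integrable gaussian (\<lambda>t. normalized_hermite m t * normalized_hermite m t)"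
    using gaussian_normalized_hermite[of m m] not_integrable_integral_eq by force
  then show ?thesis
    by (simp add: gaussian.square_integrable_def power2_eq_square)
qed

lemma poly_normalized_hermite:
  fixes p :: "complex poly"
  shows "\<exists>N c. \<forall>t. poly p (of_real t) = (\<Sum>m<N. c m * of_real (normalized_hermite m t))"
proof -
  obtain N c where c: "\<And>u. poly p (of_real (sqrt 3 / 2 * u)) = (\<Sum>m<N. c m * of_real (hermite m u))"
    using hermite_combination_poly[of p "sqrt 3 / 2"] unfolding hermite_combination_def by blast
  have "poly p (of_real t) =
      (\<Sum>m<N. c m / of_real (sqrt (1 / (2 ^ m * fact m))) * of_real (normalized_hermite m t))" for t
  proof -
    have "poly p (of_real t) = (\<Sum>m<N. c m * of_real (hermite m (2 * t / sqrt 3)))"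
      using c[of "2 * t / sqrt 3"] by simp
    also have "\<dots> = (\<Sum>m<N. c m / of_real (sqrt (1 / (2 ^ m * fact m))) * of_real (normalized_hermite m t))"
      by (intro sum.cong) (simp_all add: normalized_hermite_def)
    finally show ?thesis .
  qed
  then show ?thesis by (intro exI[of _ N] exI[of _ "\<lambda>m. c m / of_real (sqrt (1 / (2 ^ m * fact m)))"] allI)
qed

lemma scaled_psi_eq:
  "sqrt (3 ^ (m + 1) / 2) * psi m t =
     2 powr (1 / 4) * sqrt (1 / (2 ^ m * fact m)) * exp (- (t\<^sup>2 / 3)) * hermite m (2 * t / sqrt 3)"
proof -
  have "sqrt (3 ^ (m + 1) / 2) * (sqrt (2 * sqrt 2 / 3) * sqrt (1 / (6 ^ m * fact m)))
      = sqrt (3 ^ (m + 1) / 2 * ((2 * sqrt 2 / 3) * (1 / (6 ^ m * fact m))))"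
    by (simp only: real_sqrt_mult)
  also have "3 ^ (m + 1) / 2 * ((2 * sqrt 2 / 3) * (1 / (6 ^ m * fact m))) = sqrt 2 * (1 / (2 ^ m * fact m))"
  proof -
    have "(6 :: real) ^ m = 2 ^ m * 3 ^ m" by (simp add: power_mult_distrib[symmetric])
    then show ?thesis by (simp add: field_simps)
  qed
  also have "sqrt (sqrt 2 * (1 / (2 ^ m * fact m))) = 2 powr (1 / 4) * sqrt (1 / (2 ^ m * fact m))"
  proof -
    have "2 powr (1 / 4) = sqrt (sqrt (2 :: real))"
      by (simp add: powr_half_sqrt[symmetric] powr_powr)
    then show ?thesis by (simp only: real_sqrt_mult)
  qed
  finally have eq: "sqrt (3 ^ (m + 1) / 2) * (sqrt (2 * sqrt 2 / 3) * sqrt (1 / (6 ^ m * fact m))) =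
      2 powr (1 / 4) * sqrt (1 / (2 ^ m * fact m))" .
  show ?thesis
    unfolding psi_def eq[symmetric] by (simp only: mult_ac)
qed

lemma scaled_psi_ground_state:
  "complex_of_real (sqrt (3 ^ (m + 1) / 2) * psi m t) = of_real (ground_state t) * of_real (normalized_hermite m t)"
  unfolding scaled_psi_eq ground_state_def normalized_hermite_def by simp

text \<open>
  Division of \<open>f\<close> by the ground state gives a function that is square integrable for the normal law.
  Approximate it there by a polynomial, expand the polynomial in Hermite polynomials, and multiply
  by the ground state again.
\<close>

lemma dense_ground_state_normalized_hermite:
  assumes f: "f \<in> L2w (sqrt (2 / 3))" and \<epsilon>: "\<epsilon> > 0"
  shows "\<exists>N c. L2w_norm (sqrt (2 / 3))
           (\<lambda>t. f t - (\<Sum>m<N. c m * (of_real (ground_state t) * of_real (normalized_hermite m t)))) < \<epsilon>"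
proof -
  obtain g where g [measurable]: "g \<in> borel_measurable borel" and ae: "AE t in lebesgue. f t = g t"
    using f complex_lebesgue_borel_version[of f] by (auto simp: L2w_def)
  define F where "F t = g t / of_real (ground_state t)" for t
  have [measurable]: "F \<in> borel_measurable borel"
    unfolding F_def by measurable
  have gF: "g t = of_real (ground_state t) * F t" for t
    using ground_state_pos[of t] by (simp add: F_def)
  have "(\<lambda>t. of_real (ground_state t) * F t) \<in> L2w (sqrt (2 / 3))"
    using L2w_cong_AE[OF f g ae] by (simp add: gF[symmetric])
  then have "gaussian.poly_limit F"
    by (intro gaussian.poly_limit_square_integrable) (simp add: ground_state_mult_in_L2w_iff)
  then obtain p where p: "(\<integral>t. (cmod (F t - poly p (of_real t)))\<^sup>2 \<partial>gaussian) < \<epsilon>\<^sup>2"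
    using \<epsilon> unfolding gaussian.poly_limit_def by (meson zero_less_power)
  obtain N c where c: "\<And>t. poly p (of_real t) = (\<Sum>m<N. c m * of_real (normalized_hermite m t))"
    using poly_normalized_hermite[of p] by blast
  let ?S = "\<lambda>t. \<Sum>m<N. c m * (of_real (ground_state t) * of_real (normalized_hermite m t))"
  have fm: "f \<in> borel_measurable lebesgue" using f by (simp add: L2w_def)
  have S: "?S \<in> borel_measurable borel" by measurable
  have "L2w_norm (sqrt (2 / 3)) (\<lambda>t. f t - ?S t) = L2w_norm (sqrt (2 / 3)) (\<lambda>t. g t - ?S t)"
  proof (rule L2w_norm_cong_AE)
    show "(\<lambda>t. f t - ?S t) \<in> borel_measurable lebesgue" "(\<lambda>t. g t - ?S t) \<in> borel_measurable lebesgue"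
      using measurable_completion[of ?S lborel borel] measurable_completion[of g lborel borel] S g
      by (auto intro!: borel_measurable_diff[OF fm] borel_measurable_diff)
    show "AE t in lebesgue. f t - ?S t = g t - ?S t"
      using ae by eventually_elim simp
  qed
  also have "(\<lambda>t. g t - ?S t) = (\<lambda>t. of_real (ground_state t) * (F t - poly p (of_real t)))"
    by (simp add: gF c right_diff_distrib sum_distrib_left mult_ac)
  also have "L2w_norm (sqrt (2 / 3)) \<dots> = sqrt (\<integral>t. (cmod (F t - poly p (of_real t)))\<^sup>2 \<partial>gaussian)"
    by (rule L2w_norm_ground_state) (use gaussian.square_integrable_poly[of p] in \<open>simp add: gaussian.square_integrable_def\<close>)
  also have "\<dots> < \<epsilon>"
    using real_sqrt_less_mono[OF p] \<epsilon> by simp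
  finally show ?thesis by blast
qed

theorem proposition5p2:
  fixes \<alpha> :: real
  assumes "\<alpha> = sqrt (2 / 3)"
  shows "(\<forall>m t. sqrt (3 ^ (m + 1) / 2) * psi m t =
            2 powr (1 / 4) * sqrt (1 / (2 ^ m * fact m)) * exp (- (t\<^sup>2 / 3))
              * hermite m (2 * t / sqrt 3)) \<and>
         L2w_orthonormal_basis \<alpha> (\<lambda>m t. complex_of_real (sqrt (3 ^ (m + 1) / 2) * psi m t))"
  unfolding L2w_orthonormal_basis_def scaled_psi_ground_state assms
proof (intro conjI allI ballI impI)
  show "sqrt (3 ^ (m + 1) / 2) * psi m t =
            2 powr (1 / 4) * sqrt (1 / (2 ^ m * fact m)) * exp (- (t\<^sup>2 / 3))
              * hermite m (2 * t / sqrt 3)" for m t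
    by (rule scaled_psi_eq)
  show "(\<lambda>t. of_real (ground_state t) * of_real (normalized_hermite m t)) \<in> L2w (sqrt (2 / 3))" for m
    by (simp add: ground_state_mult_in_L2w_iff square_integrable_normalized_hermite)
  show "L2w_inner (sqrt (2 / 3)) (\<lambda>t. of_real (ground_state t) * of_real (normalized_hermite m t))
          (\<lambda>t. of_real (ground_state t) * of_real (normalized_hermite n t)) = (if m = n then 1 else 0)" for m n
    using gaussian_normalized_hermite[of m n]
    by (subst L2w_inner_ground_state) (simp_all del: of_real_mult add: of_real_mult[symmetric])
qed (rule dense_ground_state_normalized_hermite)

end
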